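(* Let $\alpha$ be a smooth function of involutive type and of generic type and let $\mathcal I=\{dz-p\,dx-q\,dy,\ dp-\alpha\,dq\}_{\mathrm{diff}}$. Let $\xi(t)$ be an arbitrary smooth function, and let $\mu(t)$ be a solution of the ordinary differential equation (for the unknown function $x_3(t)$) $$\frac{dx_3}{dt}-\overline\alpha(-\xi'(t),\xi(t),x_3(t),t)=0.$$ Then $$S_1:=\{(s,\varphi_1(s,-\xi'(t),\xi(t),\mu(t),t),\psi_1(s,-\xi'(t),\xi(t),\mu(t),t),\mu(t),t)\mid s\in I_1,\ t\in J_1\}\subset J^1(2,1)$$ is a two-dimensional integral manifold of $\mathcal I$, where $I_1$ and $J_1$ are some open intervals in $\mathbb R$.
   Context: All objects are $C^\infty$ and all considerations are local. $J^1(2,1)=PT^*J^0(2,1)$, where $J^0(2,1)$ is a three-dimensional manifold, with canonical local coordinates $(x,y,z,p,q)$ in which the contact form is $dz-p\,dx-q\,dy$. $\{\omega_1,\dots,\omega_r\}_{\mathrm{diff}}$ denotes the ideal of differential forms generated by the $\omega_i$ and $d\omega_i$. An integral manifold of an ideal $\mathcal J$ on $M$ is a submanifold $\iota\colon N\hookrightarrow M$ with $\iota^*\mathcal J=\{0\}$. The function $\alpha=\alpha(x,y,z,p,q)$ is of involutive type if $\alpha_x+p\alpha_z-\alpha(\alpha_y+q\alpha_z)=0$ on its domain, and of generic type if $1+x(\alpha_y+q\alpha_z)\ne0$. Define $\Phi_1(x,y,z,p,q)=(x_0,x_1,x_2,x_3,x_4)$ by $$x_0=x,\quad x_1=y+\alpha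 x,\quad x_2=z-px-qy,\quad x_3=p,\quad x_4=q .$$ For generic $\alpha$ this is a local diffeomorphism; fix a local inverse $\Phi_1^{-1}$ on an open set $V_1\subset\mathbb R\times U_1$ (with $U_1\subset\mathbb R^4$ open with coordinates $(x_1,\dots,x_4)$, taken so that $V_1$ is the product of an open interval and $U_1$), and denote by $\varphi_1$ and $\psi_1$ the second ($y$) and third ($z$) components of $\Phi_1^{-1}$. Put $\overline\alpha=\alpha\circ\Phi_1^{-1}$; by involutivity $\overline\alpha$ does not depend on $x_0$, and it is regarded as a function $\overline\alpha(x_1,x_2,x_3,x_4)$ on $U_1$. The intervals $I_1,J_1$ are such that $(s,-\xi'(t),\xi(t),\mu(t),t)\in V_1$ for $s\in I_1,t\in J_1$. *)

theory Defs
  imports "HOL-Analysis.Analysis"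
begin

section \<open>Smooth maps on open sets\<close>

primrec Ck_on :: "nat \<Rightarrow> 'a::euclidean_space set \<Rightarrow> ('a \<Rightarrow> 'b::real_normed_vector) \<Rightarrow> bool" where
  "Ck_on 0 = (\<lambda>S f. continuous_on S f)"
| "Ck_on (Suc k) = (\<lambda>S f. (\<forall>x\<in>S. f differentiable (at x)) \<and>
      (\<forall>v. Ck_on k S (\<lambda>x. frechet_derivative f (at x) v)))"

text \<open>Only meaningful for open \<open>S\<close>: derivatives are taken at points of \<open>S\<close> in the whole space.\<close>

definition smooth_on :: "'a::euclidean_space set \<Rightarrow> ('a \<Rightarrow> 'b::real_normed_vector) \<Rightarrow> bool" where
  "smooth_on S f \<longleftrightarrow> (\<forall>k. Ck_on k S f)"

definition diffeo ::
  "'a::euclidean_space set \<Rightarrow> 'b::euclidean_space set \<Rightarrow> ('a \<Rightarrow> 'b) \<Rightarrow> ('b \<Rightarrow> 'a) \<Rightarrow> bool" where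
  "diffeo W V f g \<longleftrightarrow> open W \<and> open V \<and> smooth_on W f \<and> smooth_on V g \<and>
     f ` W \<subseteq> V \<and> g ` V \<subseteq> W \<and> (\<forall>a\<in>W. g (f a) = a) \<and> (\<forall>b\<in>V. f (g b) = b)"

definition open_interval :: "real set \<Rightarrow> bool" where
  "open_interval I \<longleftrightarrow> open I \<and> is_interval I \<and> I \<noteq> {}"


section \<open>Differential forms\<close>

text \<open>
  A (not necessarily homogeneous) differential form on an open subset of \<open>'a\<close> is a function
  taking a point and a list of tangent vectors; its values on lists of length \<open>k\<close> are its
  component of degree \<open>k\<close>. Being alternating makes the components of degree above
  \<open>DIM('a)\<close> vanish. Values at points outside the open set carry no meaning.
\<close>

type_synonym 'a dform = "'a \<Rightarrow> 'a list \<Rightarrow> real"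

definition is_form :: "'a::euclidean_space set \<Rightarrow> 'a dform \<Rightarrow> bool" where
  "is_form U \<theta> \<longleftrightarrow>
     (\<forall>a\<in>U. \<forall>us ws. linear (\<lambda>v. \<theta> a (us @ v # ws))) \<and>
     (\<forall>a\<in>U. \<forall>vs. \<not> distinct vs \<longrightarrow> \<theta> a vs = 0) \<and>
     (\<forall>vs. smooth_on U (\<lambda>a. \<theta> a vs))"

definition fun_form :: "('a \<Rightarrow> real) \<Rightarrow> 'a dform" where
  "fun_form f = (\<lambda>a vs. if vs = [] then f a else 0)"

definition form_add :: "'a dform \<Rightarrow> 'a dform \<Rightarrow> 'a dform" where
  "form_add \<theta> \<eta> = (\<lambda>a vs. \<theta> a vs + \<eta> a vs)"

text \<open>
  The wedge product as a sum over shuffles: the positions in \<open>A\<close> go to the first factor, the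
  others to the second, with the sign of the resulting permutation. The normalisation is
  \<open>(\<theta> \<and> \<eta>)(v, w) = \<theta>(v) \<eta>(w) - \<theta>(w) \<eta>(v)\<close> for 1-forms.
\<close>

definition shuffle_sign :: "nat set \<Rightarrow> real" where
  "shuffle_sign A = (-1) ^ card {(i, j). i \<in> A \<and> j \<notin> A \<and> j < i}"

definition wedge :: "'a dform \<Rightarrow> 'a dform \<Rightarrow> 'a dform" where
  "wedge \<theta> \<eta> = (\<lambda>a vs. \<Sum>A\<in>Pow {..<length vs}.
      shuffle_sign A * \<theta> a (nths vs A) * \<eta> a (nths vs (- A)))"

text \<open>
  The invariant formula for the exterior derivative evaluated on constant vector fields, whose
  brackets vanish.
\<close>

definition ext_d :: "'a::euclidean_space dform \<Rightarrow> 'a dform" where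
  "ext_d \<omega> = (\<lambda>a vs. \<Sum>i<length vs.
      (-1) ^ i * frechet_derivative (\<lambda>b. \<omega> b (take i vs @ drop (Suc i) vs)) (at a) (vs ! i))"

text \<open>The two-sided ideal generated by \<open>G\<close> in the algebra of differential forms on \<open>U\<close>.\<close>

inductive_set form_ideal :: "'a::euclidean_space set \<Rightarrow> 'a dform set \<Rightarrow> 'a dform set"
  for U :: "'a set" and G :: "'a dform set" where
  zero: "(\<lambda>a vs. 0) \<in> form_ideal U G"
| gen: "\<omega> \<in> G \<Longrightarrow> \<omega> \<in> form_ideal U G"
| add: "\<omega> \<in> form_ideal U G \<Longrightarrow> \<eta> \<in> form_ideal U G \<Longrightarrow> form_add \<omega> \<eta> \<in> form_ideal U G"
| left: "is_form U \<theta> \<Longrightarrow> \<omega> \<in> form_ideal U G \<Longrightarrow> wedge \<theta> \<omega> \<in> form_ideal U G"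
| right: "is_form U \<theta> \<Longrightarrow> \<omega> \<in> form_ideal U G \<Longrightarrow> wedge \<omega> \<theta> \<in> form_ideal U G"

definition diff_ideal :: "'a::euclidean_space set \<Rightarrow> 'a dform set \<Rightarrow> 'a dform set" where
  "diff_ideal U G = form_ideal U (G \<union> ext_d ` G)"


section \<open>Submanifolds and integral manifolds\<close>

definition submanifold :: "nat \<Rightarrow> 'a::euclidean_space set \<Rightarrow> bool" where
  "submanifold k S \<longleftrightarrow> (\<forall>a\<in>S. \<exists>(W::'a set) (V::'a set) f g K.
      a \<in> W \<and> diffeo W V f g \<and> subspace K \<and> dim K = k \<and> f ` (S \<inter> W) = V \<inter> K)"

definition tangent_space :: "'a::euclidean_space set \<Rightarrow> 'a \<Rightarrow> 'a set" where
  "tangent_space S a = {v. \<exists>e>0. \<exists>c::real \<Rightarrow> 'a. smooth_on {-e<..<e} c \<and>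
      c ` {-e<..<e} \<subseteq> S \<and> c 0 = a \<and> (c has_vector_derivative v) (at 0)}"

text \<open>
  The pullback of \<open>\<omega>\<close> along the inclusion of a submanifold \<open>S\<close>: since the differential of the
  inclusion is the inclusion of tangent spaces, it is the restriction of \<open>\<omega>\<close> to vectors tangent
  to \<open>S\<close>, extended by 0 to make it a total function.
\<close>

definition pullback_incl :: "'a::euclidean_space set \<Rightarrow> 'a dform \<Rightarrow> 'a dform" where
  "pullback_incl S \<omega> =
     (\<lambda>a vs. if a \<in> S \<and> set vs \<subseteq> tangent_space S a then \<omega> a vs else 0)"

definition integral_manifold ::
  "nat \<Rightarrow> 'a::euclidean_space set \<Rightarrow> 'a dform set \<Rightarrow> 'a set \<Rightarrow> bool" where
  "integral_manifold k U \<J> S \<longleftrightarrow>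
     S \<subseteq> U \<and> submanifold k S \<and> pullback_incl S ` \<J> = {\<lambda>a vs. 0}"


section \<open>The jet space and the first-order system\<close>

text \<open>Points of \<open>J\<^sup>1(2,1)\<close> in canonical coordinates \<open>(x, y, z, p, q)\<close>.\<close>

type_synonym jet = "real \<times> real \<times> real \<times> real \<times> real"

definition crd_x :: "jet \<Rightarrow> real" where "crd_x = (\<lambda>(x, y, z, p, q). x)"
definition crd_y :: "jet \<Rightarrow> real" where "crd_y = (\<lambda>(x, y, z, p, q). y)"
definition crd_z :: "jet \<Rightarrow> real" where "crd_z = (\<lambda>(x, y, z, p, q). z)"
definition crd_p :: "jet \<Rightarrow> real" where "crd_p = (\<lambda>(x, y, z, p, q). p)"
definition crd_q :: "jet \<Rightarrow> real" where "crd_q = (\<lambda>(x, y, z, p, q). q)"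

definition par_x :: "(jet \<Rightarrow> real) \<Rightarrow> jet \<Rightarrow> real" where
  "par_x f = (\<lambda>(x, y, z, p, q). deriv (\<lambda>h. f (h, y, z, p, q)) x)"
definition par_y :: "(jet \<Rightarrow> real) \<Rightarrow> jet \<Rightarrow> real" where
  "par_y f = (\<lambda>(x, y, z, p, q). deriv (\<lambda>h. f (x, h, z, p, q)) y)"
definition par_z :: "(jet \<Rightarrow> real) \<Rightarrow> jet \<Rightarrow> real" where
  "par_z f = (\<lambda>(x, y, z, p, q). deriv (\<lambda>h. f (x, y, h, p, q)) z)"

definition d_crd :: "(jet \<Rightarrow> real) \<Rightarrow> jet dform" where
  "d_crd c = ext_d (fun_form c)"

text \<open>\<open>dz - p dx - q dy\<close>\<close>

definition contact_form :: "jet dform" where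
  "contact_form = (\<lambda>m vs.
     d_crd crd_z m vs - crd_p m * d_crd crd_x m vs - crd_q m * d_crd crd_y m vs)"

text \<open>\<open>dp - \<alpha> dq\<close>\<close>

definition alpha_form :: "(jet \<Rightarrow> real) \<Rightarrow> jet dform" where
  "alpha_form \<alpha> = (\<lambda>m vs. d_crd crd_p m vs - \<alpha> m * d_crd crd_q m vs)"

definition involutive_type :: "jet set \<Rightarrow> (jet \<Rightarrow> real) \<Rightarrow> bool" where
  "involutive_type U \<alpha> \<longleftrightarrow> (\<forall>m\<in>U.
     par_x \<alpha> m + crd_p m * par_z \<alpha> m - \<alpha> m * (par_y \<alpha> m + crd_q m * par_z \<alpha> m) = 0)"

definition generic_type :: "jet set \<Rightarrow> (jet \<Rightarrow> real) \<Rightarrow> bool" where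
  "generic_type U \<alpha> \<longleftrightarrow> (\<forall>m\<in>U. 1 + crd_x m * (par_y \<alpha> m + crd_q m * par_z \<alpha> m) \<noteq> 0)"

definition Phi1 :: "(jet \<Rightarrow> real) \<Rightarrow> jet \<Rightarrow> real \<times> real \<times> real \<times> real \<times> real" where
  "Phi1 \<alpha> = (\<lambda>(x, y, z, p, q). (x, y + \<alpha> (x, y, z, p, q) * x, z - p * x - q * y, p, q))"

text \<open>
  The common value of \<open>\<alpha> \<circ> \<Psi>\<close> on the segment \<open>T \<times> {u}\<close>, where \<open>\<Psi>\<close> is the local inverse of
  \<open>Phi1 \<alpha>\<close>. That there is such a value is a consequence of involutivity and is not built in.
\<close>

definition alpha_bar :: "(jet \<Rightarrow> real) \<Rightarrow> (real \<times> real \<times> real \<times> real \<times> real \<Rightarrow> jet) \<Rightarrow>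
    real set \<Rightarrow> real \<times> real \<times> real \<times> real \<Rightarrow> real" where
  "alpha_bar \<alpha> \<Psi> T u = (THE c. \<forall>x0\<in>T. \<alpha> (\<Psi> (x0, u)) = c)"

end

(*
  Along the fibres of the local inverse Psi in direction x0 the function alpha is constant, so on
  the surface alpha = mu'(t). Inverting Phi1 there gives the explicit parametrisation
    y = - xi'(t) - s mu'(t),   z = xi(t) + s mu(t) + t y,   p = mu(t),   q = t.
  Differentiating the equations
    p = mu(q),  y = - xi'(q) - x mu'(q),  z = xi(q) + x mu(q) + q y,  alpha = mu'(q)
  along curves in the surface yields linear relations between the components of its tangent
  vectors, from which the two generators and their exterior derivatives vanish. The function mu is
  smooth because it solves an ODE with smooth right-hand side, and the surface is a submanifold
  because in the coordinates Phi1 it is a graph over (x0, x4).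
*)
theory Submission
  imports Defs
begin

section \<open>Calculus of \<open>C\<^sup>k\<close> maps\<close>

lemma Ck_on_Suc_D:
  assumes "Ck_on (Suc k) S f"
  shows "x \<in> S \<Longrightarrow> (f has_derivative frechet_derivative f (at x)) (at x)"
    and "Ck_on k S (\<lambda>x. frechet_derivative f (at x) v)"
  using assms by (auto simp: frechet_derivative_works[symmetric])

text \<open>Each point of the open set \<open>S\<close> has a neighbourhood on which the two maps
  coincide, so their derivatives there agree, although these are taken in the whole space.\<close>

lemma Ck_on_cong:
  assumes "open S" "\<And>x. x \<in> S \<Longrightarrow> f x = g x" "Ck_on k S f"
  shows "Ck_on k S g"
  using assms(2,3)
proof (induction k arbitrary: f g)
  case 0
  then show ?case using continuous_on_cong by fastforce
next
  case (Suc k)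
  have d: "(g has_derivative frechet_derivative f (at x)) (at x)" if "x \<in> S" for x
    using has_derivative_transform_within_open[OF Ck_on_Suc_D(1)[OF Suc.prems(2) that] assms(1) that]
      Suc.prems(1) by blast
  then have "frechet_derivative f (at x) v = frechet_derivative g (at x) v" if "x \<in> S" for x v
    using frechet_derivative_at that by metis
  from Suc.IH[OF this Ck_on_Suc_D(2)[OF Suc.prems(2)]] d show ?case
    by (auto simp: differentiable_def)
qed

text \<open>By uniqueness of derivatives, any explicit family \<open>f'\<close> may replace
  \<open>frechet_derivative\<close>. This is the introduction rule for the inductions on
  \<open>k\<close> below.\<close>

lemma Ck_on_Suc_has_derivative:
  assumes "open S" "\<And>x. x \<in> S \<Longrightarrow> (f has_derivative f' x) (at x)"
    "\<And>v. Ck_on k S (\<lambda>x. f' x v)"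
  shows "Ck_on (Suc k) S f"
proof -
  have "f' x v = frechet_derivative f (at x) v" if "x \<in> S" for x v
    using assms(2)[OF that] frechet_derivative_at by metis
  from Ck_on_cong[OF assms(1) this assms(3)] show ?thesis
    using assms(2) by (auto simp: differentiable_def)
qed

lemma Ck_on_lower: "Ck_on (Suc k) S f \<Longrightarrow> Ck_on k S f"
proof (induction k arbitrary: f)
  case 0
  then show ?case
    by (simp add: continuous_at_imp_continuous_on differentiable_imp_continuous_within)
qed simp

lemma Ck_on_subset: "Ck_on k S f \<Longrightarrow> S' \<subseteq> S \<Longrightarrow> Ck_on k S' f"
  by (induction k arbitrary: f) (auto intro: continuous_on_subset)

lemma Ck_on_const: "open S \<Longrightarrow> Ck_on k S (\<lambda>x. c)"
  by (induction k arbitrary: c) auto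

lemma Ck_on_bounded_linear:
  assumes "open S" "bounded_linear f"
  shows "Ck_on k S f"
proof (cases k)
  case 0
  then show ?thesis using assms by (simp add: linear_continuous_on)
next
  case (Suc n)
  show ?thesis
    unfolding Suc
    by (rule Ck_on_Suc_has_derivative[OF assms(1) bounded_linear_imp_has_derivative[OF assms(2)]
          Ck_on_const[OF assms(1)]])
qed

lemma Ck_on_add:
  "open S \<Longrightarrow> Ck_on k S f \<Longrightarrow> Ck_on k S g \<Longrightarrow> Ck_on k S (\<lambda>x. f x + g x)"
proof (induction k arbitrary: f g)
  case (Suc k)
  show ?case
    by (intro Ck_on_Suc_has_derivative[OF Suc.prems(1)
          has_derivative_add[OF Ck_on_Suc_D(1)[OF Suc.prems(2)] Ck_on_Suc_D(1)[OF Suc.prems(3)]]]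
        Suc.IH Suc.prems(1) Ck_on_Suc_D(2)[OF Suc.prems(2)] Ck_on_Suc_D(2)[OF Suc.prems(3)])
qed (simp add: continuous_on_add)

text \<open>Induction by the Leibniz rule: each of the two summands of the derivative pairs one
  differentiated factor with one undifferentiated factor of lowered order.\<close>

lemma Ck_on_bilinear:
  assumes "open S" "bounded_bilinear h"
  shows "Ck_on k S f \<Longrightarrow> Ck_on k S g \<Longrightarrow> Ck_on k S (\<lambda>x. h (f x) (g x))"
proof (induction k arbitrary: f g)
  case 0
  then show ?case using bounded_bilinear.continuous_on[OF assms(2)] by simp
next
  case (Suc k)
  let ?f' = "\<lambda>x. frechet_derivative f (at x)" and ?g' = "\<lambda>x. frechet_derivative g (at x)"
  have "((\<lambda>x. h (f x) (g x)) has_derivative (\<lambda>v. h (f x) (?g' x v) + h (?f' x v) (g x))) (at x)"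
    if "x \<in> S" for x
    using bounded_bilinear.FDERIV[OF assms(2) Suc.prems[THEN Ck_on_Suc_D(1), OF that]] .
  moreover have "Ck_on k S (\<lambda>x. h (f x) (?g' x v) + h (?f' x v) (g x))" for v
    by (rule Ck_on_add[OF assms(1)
          Suc.IH[OF Ck_on_lower[OF Suc.prems(1)] Ck_on_Suc_D(2)[OF Suc.prems(2)]]
          Suc.IH[OF Ck_on_Suc_D(2)[OF Suc.prems(1)] Ck_on_lower[OF Suc.prems(2)]]])
  ultimately show ?case
    by (rule Ck_on_Suc_has_derivative[OF assms(1)])
qed

lemma Ck_on_linear_image:
  assumes "open S" "bounded_linear L"
  shows "Ck_on k S f \<Longrightarrow> Ck_on k S (\<lambda>x. L (f x))"
proof (induction k arbitrary: f)
  case 0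
  then show ?case using bounded_linear.continuous_on[OF assms(2)] by auto
next
  case (Suc k)
  show ?case
    by (intro Ck_on_Suc_has_derivative[OF assms(1) bounded_linear.has_derivative[OF assms(2)
            Ck_on_Suc_D(1)[OF Suc.prems]]] Suc.IH Ck_on_Suc_D(2)[OF Suc.prems])
qed

lemma Ck_on_sum:
  assumes "open S" "finite A" "\<And>i. i \<in> A \<Longrightarrow> Ck_on k S (f i)"
  shows "Ck_on k S (\<lambda>x. \<Sum>i\<in>A. f i x)"
  using assms(2,3)
  by (induction A rule: finite_induct) (simp_all add: Ck_on_const Ck_on_add assms(1))

text \<open>The pair is the sum of the images of its components under the two linear embeddings into
  the product.\<close>

lemma Ck_on_Pair:
  assumes "open S" "Ck_on k S f" "Ck_on k S g"
  shows "Ck_on k S (\<lambda>x. (f x, g x))"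
proof -
  have "Ck_on k S (\<lambda>x. (f x, 0) + (0, g x))"
    by (rule Ck_on_add[OF assms(1)
          Ck_on_linear_image[OF assms(1) bounded_linear_Pair[OF bounded_linear_ident bounded_linear_zero] assms(2)]
          Ck_on_linear_image[OF assms(1) bounded_linear_Pair[OF bounded_linear_zero bounded_linear_ident] assms(3)]])
  then show ?thesis by simp
qed

text \<open>Induction by the chain rule. The induction hypothesis only covers the derivative of
  \<open>g\<close> in a fixed direction, whereas the chain rule produces one that moves with
  \<open>x\<close>.\<close>

lemma Ck_on_compose:
  fixes f :: "'a::euclidean_space \<Rightarrow> 'b::euclidean_space"
    and g :: "'b \<Rightarrow> 'c::real_normed_vector"
  assumes "open S"
  shows "Ck_on k S f \<Longrightarrow> Ck_on k R g \<Longrightarrow> f ` S \<subseteq> R \<Longrightarrow> Ck_on k S (\<lambda>x. g (f x))"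
proof (induction k arbitrary: g)
  case 0
  then show ?case using continuous_on_compose2[of R g S f] by simp
next
  case (Suc k)
  let ?f' = "\<lambda>x. frechet_derivative f (at x)" and ?g' = "\<lambda>y. frechet_derivative g (at y)"
  show ?case
  proof (rule Ck_on_Suc_has_derivative[OF assms])
    fix x assume x: "x \<in> S"
    then have fx: "f x \<in> R" using Suc.prems(3) by blast
    show "((\<lambda>x. g (f x)) has_derivative (\<lambda>v. ?g' (f x) (?f' x v))) (at x)"
      by (rule has_derivative_compose[OF Ck_on_Suc_D(1)[OF Suc.prems(1) x]
            Ck_on_Suc_D(1)[OF Suc.prems(2) fx]])
  next
    fix v
    \<comment> \<open>The moving direction is expanded in the standard basis, which leaves
      derivatives of \<open>g\<close> in fixed directions with scalar coefficients.\<close>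
    let ?s = "\<lambda>x. \<Sum>b\<in>Basis. (?f' x v \<bullet> b) *\<^sub>R ?g' (f x) b"
    have "Ck_on k S (\<lambda>x. (?f' x v \<bullet> b) *\<^sub>R ?g' (f x) b)" for b
      by (rule Ck_on_bilinear[OF assms bounded_bilinear_scaleR
            Ck_on_linear_image[OF assms bounded_linear_inner_left Ck_on_Suc_D(2)[OF Suc.prems(1)]]
            Suc.IH[OF Ck_on_lower[OF Suc.prems(1)] Ck_on_Suc_D(2)[OF Suc.prems(2)] Suc.prems(3)]])
    then have "Ck_on k S ?s"
      by (rule Ck_on_sum[OF assms finite_Basis])
    moreover have "?s x = ?g' (f x) (?f' x v)" if "x \<in> S" for x
    proof -
      have "f x \<in> R" using Suc.prems(3) that by blast
      then have lin: "linear (?g' (f x))"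
        by (rule has_derivative_linear[OF Ck_on_Suc_D(1)[OF Suc.prems(2)]])
      have "?g' (f x) (?f' x v) = ?g' (f x) (\<Sum>b\<in>Basis. (?f' x v \<bullet> b) *\<^sub>R b)"
        by (simp add: euclidean_representation)
      also have "\<dots> = ?s x" by (simp add: linear_sum[OF lin] linear_cmul[OF lin])
      finally show ?thesis by simp
    qed
    ultimately show "Ck_on k S (\<lambda>x. ?g' (f x) (?f' x v))"
      by (rule Ck_on_cong[OF assms, rotated])
  qed
qed

section \<open>Rules for smooth maps, inherited from every finite order\<close>

lemma smooth_on_has_derivative:
  "smooth_on S f \<Longrightarrow> x \<in> S \<Longrightarrow> (f has_derivative frechet_derivative f (at x)) (at x)"
  unfolding smooth_on_def using Ck_on_Suc_D by blast

lemma smooth_on_continuous: "smooth_on S f \<Longrightarrow> continuous_on S f"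
  unfolding smooth_on_def using Ck_on.simps(1) by metis

lemma smooth_on_subset: "smooth_on S f \<Longrightarrow> S' \<subseteq> S \<Longrightarrow> smooth_on S' f"
  unfolding smooth_on_def using Ck_on_subset by blast

lemma smooth_on_compose:
  fixes f :: "'a::euclidean_space \<Rightarrow> 'b::euclidean_space"
  assumes "open S" "smooth_on S f" "smooth_on R g" "f ` S \<subseteq> R"
  shows "smooth_on S (\<lambda>x. g (f x))"
  using assms Ck_on_compose unfolding smooth_on_def by blast

lemma smooth_on_bounded_linear: "open S \<Longrightarrow> bounded_linear f \<Longrightarrow> smooth_on S f"
  unfolding smooth_on_def using Ck_on_bounded_linear by blast

lemma smooth_on_const: "open S \<Longrightarrow> smooth_on S (\<lambda>x. c)"
  unfolding smooth_on_def using Ck_on_const by blast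

lemma smooth_on_add:
  "open S \<Longrightarrow> smooth_on S f \<Longrightarrow> smooth_on S g \<Longrightarrow> smooth_on S (\<lambda>x. f x + g x)"
  unfolding smooth_on_def using Ck_on_add by blast

lemma smooth_on_minus:
  "open S \<Longrightarrow> smooth_on S f \<Longrightarrow> smooth_on S (\<lambda>x. - f x)"
  unfolding smooth_on_def
  using Ck_on_linear_image[OF _ bounded_linear_minus[OF bounded_linear_ident]] by blast

lemma smooth_on_Pair:
  "open S \<Longrightarrow> smooth_on S f \<Longrightarrow> smooth_on S g \<Longrightarrow> smooth_on S (\<lambda>x. (f x, g x))"
  unfolding smooth_on_def using Ck_on_Pair by blast

lemma smooth_on_real_derivative:
  fixes f :: "real \<Rightarrow> real"
  assumes "smooth_on S f" "x \<in> S"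
  shows "(f has_real_derivative deriv f x) (at x)"
proof -
  have "f differentiable at x"
    using smooth_on_has_derivative[OF assms] differentiableI by blast
  then show ?thesis
    using real_differentiable_def DERIV_imp_deriv by metis
qed

text \<open>For a function of one variable \<open>deriv\<close> is the Frechet derivative in
  direction 1.\<close>

lemma smooth_on_deriv:
  fixes f :: "real \<Rightarrow> real"
  assumes "open S" "smooth_on S f"
  shows "smooth_on S (deriv f)"
proof -
  have "frechet_derivative f (at x) 1 = deriv f x" if "x \<in> S" for x
    using frechet_derivative_at[of f "(*) (deriv f x)" x]
      smooth_on_real_derivative[OF assms(2) that]
    by (metis has_field_derivative_def mult.right_neutral)
  note Ck_on_cong[OF assms(1) this Ck_on_Suc_D(2)]
  then show ?thesis
    using assms(2) unfolding smooth_on_def by blast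
qed

section \<open>Forms in the ideal of the system\<close>

lemma frechet_derivative_fun_form:
  "frechet_derivative (\<lambda>b. fun_form c b vs) (at a) =
    (if vs = [] then frechet_derivative c (at a) else (\<lambda>_. 0))"
  by (auto simp: fun_form_def)

lemma ext_d_fun_form:
  "ext_d (fun_form c) a vs = (if length vs = 1 then frechet_derivative c (at a) (hd vs) else 0)"
proof -
  consider "vs = []" | v where "vs = [v]" | "length vs \<ge> 2"
    by (cases vs; cases "tl vs") auto
  then show ?thesis
  proof cases
    case 3
    then have "take i vs @ drop (Suc i) vs \<noteq> []" if "i < length vs" for i
      using that by auto
    then have "ext_d (fun_form c) a vs = 0"
      unfolding ext_d_def frechet_derivative_fun_form by (intro sum.neutral) auto
    then show ?thesis using 3 by simp
  qed (simp_all add: ext_d_def frechet_derivative_fun_form)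
qed

lemma bounded_linear_crd:
  "bounded_linear crd_x" "bounded_linear crd_y" "bounded_linear crd_z"
  "bounded_linear crd_p" "bounded_linear crd_q"
  unfolding crd_x_def crd_y_def crd_z_def crd_p_def crd_q_def case_prod_beta
  by (intro bounded_linear_fst bounded_linear_fst_comp bounded_linear_snd_comp
      bounded_linear_ident)+

lemma d_crd:
  "bounded_linear c \<Longrightarrow> d_crd c a vs = (if length vs = 1 then c (hd vs) else 0)"
  unfolding d_crd_def ext_d_fun_form
  by (simp flip: frechet_derivative_at[OF bounded_linear_imp_has_derivative])

lemma contact_form_eq:
  "contact_form a vs = (if length vs = 1
    then crd_z (hd vs) - crd_p a * crd_x (hd vs) - crd_q a * crd_y (hd vs) else 0)"
  by (simp add: contact_form_def d_crd bounded_linear_crd)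

lemma alpha_form_eq:
  "alpha_form \<alpha> a vs = (if length vs = 1 then crd_p (hd vs) - \<alpha> a * crd_q (hd vs) else 0)"
  by (simp add: alpha_form_def d_crd bounded_linear_crd)

text \<open>For a form concentrated in degree 1, deleting an argument leaves exactly one only when
  there were two. Hence only pairs of vectors need attention later.\<close>

lemma ext_d_one_form:
  assumes "\<And>b vs. length vs \<noteq> 1 \<Longrightarrow> \<omega> b vs = 0"
  shows "length vs \<noteq> 2 \<Longrightarrow> ext_d \<omega> a vs = 0"
    and "ext_d \<omega> a [v, w] =
      frechet_derivative (\<lambda>b. \<omega> b [w]) (at a) v - frechet_derivative (\<lambda>b. \<omega> b [v]) (at a) w"
proof -
  assume "length vs \<noteq> 2"
  then have "(\<lambda>b. \<omega> b (take i vs @ drop (Suc i) vs)) = (\<lambda>b. 0)" if "i < length vs" for i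
    using that by (intro ext assms) auto
  then show "ext_d \<omega> a vs = 0"
    unfolding ext_d_def by (intro sum.neutral) simp
next
  show "ext_d \<omega> a [v, w] =
      frechet_derivative (\<lambda>b. \<omega> b [w]) (at a) v - frechet_derivative (\<lambda>b. \<omega> b [v]) (at a) w"
    by (simp add: ext_d_def numeral_2_eq_2)
qed

text \<open>The right-hand side is the 2-form dx \<and> dp + dy \<and> dq evaluated on
  \<open>v\<close> and \<open>w\<close>.\<close>

lemma ext_d_contact_form:
  "ext_d contact_form a [v, w] =
    crd_x v * crd_p w - crd_p v * crd_x w + crd_y v * crd_q w - crd_q v * crd_y w"
proof -
  have d: "((\<lambda>b. contact_form b [w]) has_derivative
      (\<lambda>h. - crd_p h * crd_x w - crd_q h * crd_y w)) (at a)" for w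
    unfolding contact_form_eq
    by (auto intro!: derivative_eq_intros bounded_linear_imp_has_derivative bounded_linear_crd)
  have "frechet_derivative (\<lambda>b. contact_form b [w]) (at a) =
      (\<lambda>h. - crd_p h * crd_x w - crd_q h * crd_y w)" for w
    by (rule frechet_derivative_at[OF d, symmetric])
  then show ?thesis
    by (subst ext_d_one_form) (simp_all add: contact_form_eq)
qed

text \<open>The right-hand side is - d\<alpha> \<and> dq evaluated on \<open>v\<close> and
  \<open>w\<close>.\<close>

lemma ext_d_alpha_form:
  assumes "(\<alpha> has_derivative \<alpha>') (at a)"
  shows "ext_d (alpha_form \<alpha>) a [v, w] = \<alpha>' w * crd_q v - \<alpha>' v * crd_q w"
proof -
  have d: "((\<lambda>b. alpha_form \<alpha> b [w]) has_derivative (\<lambda>h. - \<alpha>' h * crd_q w)) (at a)" for w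
    unfolding alpha_form_eq by (auto intro!: derivative_eq_intros assms)
  have "frechet_derivative (\<lambda>b. alpha_form \<alpha> b [w]) (at a) = (\<lambda>h. - \<alpha>' h * crd_q w)" for w
    by (rule frechet_derivative_at[OF d, symmetric])
  then show ?thesis
    by (subst ext_d_one_form) (simp_all add: alpha_form_eq)
qed

text \<open>Every shuffle term of a wedge product evaluates its factors on sublists of
  \<open>vs\<close>, which again consist of vectors in \<open>V\<close>. Vanishing at
  \<open>a\<close> on such lists therefore passes from the generators to the whole ideal.\<close>

lemma form_ideal_vanishes:
  assumes "\<omega> \<in> form_ideal U G"
    and "\<And>\<omega> vs. \<omega> \<in> G \<Longrightarrow> set vs \<subseteq> V \<Longrightarrow> \<omega> a vs = 0"
  shows "set vs \<subseteq> V \<Longrightarrow> \<omega> a vs = 0"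
  using assms(1)
proof (induction arbitrary: vs)
  case (left \<theta> \<omega>)
  have "\<omega> a (nths vs A) = 0" for A
    using left.IH left.prems set_nths_subset by fast
  then show ?case by (simp add: wedge_def)
next
  case (right \<theta> \<omega>)
  have "\<omega> a (nths vs A) = 0" for A
    using right.IH right.prems set_nths_subset by fast
  then show ?case by (simp add: wedge_def)
qed (auto simp: form_add_def assms(2))

text \<open>Reduces the integral condition to pointwise identities on tangent vectors: the first two
  assumptions kill the generators, the third kills dx \<and> dp + dy \<and> dq, and the last kills
  d\<alpha> \<and> dq.\<close>

lemma pullback_incl_diff_ideal_eq_zero:
  assumes "\<And>a v. a \<in> S \<Longrightarrow> v \<in> tangent_space S a \<Longrightarrow>
      crd_z v = crd_p a * crd_x v + crd_q a * crd_y v"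
    and "\<And>a v. a \<in> S \<Longrightarrow> v \<in> tangent_space S a \<Longrightarrow> crd_p v = \<alpha> a * crd_q v"
    and "\<And>a v w. a \<in> S \<Longrightarrow> v \<in> tangent_space S a \<Longrightarrow> w \<in> tangent_space S a \<Longrightarrow>
      crd_x v * crd_p w - crd_p v * crd_x w + crd_y v * crd_q w - crd_q v * crd_y w = 0"
    and "\<And>a. a \<in> S \<Longrightarrow> (\<alpha> has_derivative \<alpha>' a) (at a)"
    and "\<And>a v w. a \<in> S \<Longrightarrow> v \<in> tangent_space S a \<Longrightarrow> w \<in> tangent_space S a \<Longrightarrow>
      \<alpha>' a w * crd_q v = \<alpha>' a v * crd_q w"
  shows "pullback_incl S ` diff_ideal U {contact_form, alpha_form \<alpha>} = {\<lambda>a vs. 0}"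
proof -
  have "\<omega> a vs = 0"
    if \<omega>: "\<omega> \<in> diff_ideal U {contact_form, alpha_form \<alpha>}" and a: "a \<in> S"
      and vs: "set vs \<subseteq> tangent_space S a" for \<omega> a vs
    using \<omega>[unfolded diff_ideal_def] _ vs
  proof (rule form_ideal_vanishes)
    fix \<eta> vs
    assume \<eta>: "\<eta> \<in> {contact_form, alpha_form \<alpha>} \<union> ext_d ` {contact_form, alpha_form \<alpha>}"
      and vs: "set vs \<subseteq> tangent_space S a"
    have 1: "contact_form a vs = 0" "alpha_form \<alpha> a vs = 0"
      using assms(1,2)[OF a, of "hd vs"] vs
      by (auto simp: contact_form_eq alpha_form_eq length_Suc_conv)
    have 2: "ext_d contact_form a vs = 0 \<and> ext_d (alpha_form \<alpha>) a vs = 0"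
    proof (cases "length vs = 2")
      case True
      then obtain v w where "vs = [v, w]" by (auto simp: length_Suc_conv numeral_2_eq_2)
      then show ?thesis
        using assms(3,5)[OF a, of v w] vs
        by (simp add: ext_d_contact_form ext_d_alpha_form[OF assms(4)[OF a]])
    qed (simp add: ext_d_one_form contact_form_eq alpha_form_eq)
    show "\<eta> a vs = 0" using 1 2 \<eta> by auto
  qed
  then have "pullback_incl S ` diff_ideal U {contact_form, alpha_form \<alpha>} =
      (\<lambda>_ a vs. 0) ` diff_ideal U {contact_form, alpha_form \<alpha>}"
    unfolding pullback_incl_def by (intro image_cong ext) auto
  \<comment> \<open>The ideal is nonempty, so its image under a constant map is the singleton and
    not the empty set.\<close>
  moreover have "(\<lambda>a vs. 0) \<in> diff_ideal U {contact_form, alpha_form \<alpha>}"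
    unfolding diff_ideal_def by (rule form_ideal.zero)
  ultimately show ?thesis by (simp add: image_constant)
qed

section \<open>Involutivity\<close>

lemmas has_derivative_crd [derivative_intros] =
  bounded_linear_crd[THEN bounded_linear.has_derivative]

text \<open>Links the total derivative to the one-variable derivatives in \<open>par_x\<close>,
  \<open>par_y\<close> and \<open>par_z\<close>. Directions without p and q components suffice,
  since p and q are constant along the fibres of \<open>Phi1\<close> considered below.\<close>

lemma has_derivative_partials:
  assumes "(f has_derivative f') (at m)"
  shows "f' (u, v, w, 0, 0) = u * par_x f m + v * par_y f m + w * par_z f m"
proof -
  obtain x y z p q where m: "m = (x, y, z, p, q)" by (cases m)
  note lin = has_derivative_linear[OF assms]
  have scale: "f' (h *\<^sub>R e) = h * f' e" for h e
    using linear_cmul[OF lin] by simp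
  \<comment> \<open>Chain rule along a line through \<open>m\<close> with velocity \<open>e\<close>;
    each partial derivative is the case of a coordinate direction.\<close>
  have line: "((\<lambda>h. f (g h)) has_real_derivative f' e) (at r)"
    if "(g has_derivative (\<lambda>h. h *\<^sub>R e)) (at r)" "g r = m" for g e r
    using has_derivative_compose[OF that(1), of f f'] assms that(2)
    by (simp add: has_field_derivative_def scale mult.commute[of _ "f' e"])
  have "par_x f m = f' (1, 0, 0, 0, 0)"
    unfolding m par_x_def prod.case
    by (rule DERIV_imp_deriv, rule line) (auto simp: m zero_prod_def intro!: derivative_eq_intros)
  moreover have "par_y f m = f' (0, 1, 0, 0, 0)"
    unfolding m par_y_def prod.case
    by (rule DERIV_imp_deriv, rule line) (auto simp: m zero_prod_def intro!: derivative_eq_intros)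
  moreover have "par_z f m = f' (0, 0, 1, 0, 0)"
    unfolding m par_z_def prod.case
    by (rule DERIV_imp_deriv, rule line) (auto simp: m zero_prod_def intro!: derivative_eq_intros)
  moreover have "f' (u, v, w, 0, 0) = f' (u *\<^sub>R (1, 0, 0, 0, 0) + v *\<^sub>R (0, 1, 0, 0, 0) + w *\<^sub>R (0, 0, 1, 0, 0))"
    by simp
  ultimately show ?thesis
    by (simp only: linear_add[OF lin] scale)
qed

text \<open>By the chain rule the derivative of \<open>f\<close> along the curve is
  \<open>f' v\<close>, and the affine expression gives \<open>k\<close>. Slope 1 serves the
  coordinate x on a fibre, slope 0 all quantities that are constant.\<close>

lemma derivative_along_curve:
  fixes f :: "'a::real_normed_vector \<Rightarrow> real"
  assumes c: "(c has_vector_derivative v) (at s)" and f: "(f has_derivative f') (at (c s))"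
    and T: "open T" "s \<in> T" and eq: "\<And>r. r \<in> T \<Longrightarrow> f (c r) = d + k * r"
  shows "f' v = k"
proof -
  have "((\<lambda>r. f (c r)) has_derivative (\<lambda>h. f' (h *\<^sub>R v))) (at s)"
    using has_derivative_compose[OF c[unfolded has_vector_derivative_def] f] .
  then have "((\<lambda>r. d + k * r) has_derivative (\<lambda>h. f' (h *\<^sub>R v))) (at s)"
    by (rule has_derivative_transform_within_open[OF _ T]) (rule eq)
  moreover have "((\<lambda>r. d + k * r) has_derivative (\<lambda>h. k * h)) (at s)"
    by (auto intro!: derivative_eq_intros)
  ultimately have "(\<lambda>h. f' (h *\<^sub>R v)) = (\<lambda>h. k * h)"
    by (rule has_derivative_unique)
  then show ?thesis by (metis mult.right_neutral scaleR_one)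
qed

lemma Phi1_eq_iff:
  "Phi1 \<alpha> m = (x0, x1, x2, x3, x4) \<longleftrightarrow> crd_x m = x0 \<and> crd_y m + \<alpha> m * x0 = x1 \<and>
    crd_z m - x3 * x0 - x4 * crd_y m = x2 \<and> crd_p m = x3 \<and> crd_q m = x4"
  by (cases m) (auto simp: Phi1_def crd_x_def crd_y_def crd_z_def crd_p_def crd_q_def)

lemma jet_eq_crd: "m = (crd_x m, crd_y m, crd_z m, crd_p m, crd_q m)"
  by (cases m) (simp add: crd_x_def crd_y_def crd_z_def crd_p_def crd_q_def)

lemma crd_simps [simp]:
  "crd_x (x, y, z, p, q) = x" "crd_y (x, y, z, p, q) = y" "crd_z (x, y, z, p, q) = z"
  "crd_p (x, y, z, p, q) = p" "crd_q (x, y, z, p, q) = q"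
  by (simp_all add: crd_x_def crd_y_def crd_z_def crd_p_def crd_q_def)

text \<open>
  Along \<open>s \<mapsto> \<Psi> (s, u)\<close> the derivative \<open>D\<close> of \<open>\<alpha>\<close> satisfies \<open>y' = - \<alpha> - s D\<close> and
  \<open>z' = p + q y'\<close>, so that involutivity turns \<open>D = \<alpha>\<^sub>x + y' \<alpha>\<^sub>y + z' \<alpha>\<^sub>z\<close> into
  \<open>D (1 + s (\<alpha>\<^sub>y + q \<alpha>\<^sub>z)) = 0\<close>.
\<close>

lemma involutive_const_on_fibres:
  assumes U: "open U" "smooth_on U \<alpha>" "involutive_type U \<alpha>" "generic_type U \<alpha>" "W \<subseteq> U"
    and T: "open_interval T" and \<Psi>: "diffeo W (T \<times> U1) (Phi1 \<alpha>) \<Psi>"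
    and u: "u \<in> U1" and s: "s \<in> T" "s' \<in> T"
  shows "\<alpha> (\<Psi> (s, u)) = \<alpha> (\<Psi> (s', u))"
proof -
  obtain x1 x2 x3 x4 where u_eq: "u = (x1, x2, x3, x4)" by (cases u)
  have T': "open T" "convex T"
    using T by (auto simp: open_interval_def is_interval_convex_1)
  have in_U: "\<Psi> (r, u) \<in> U" and inv: "Phi1 \<alpha> (\<Psi> (r, u)) = (r, x1, x2, x3, x4)" if "r \<in> T" for r
    using \<Psi> that u subsetD[OF U(5)] by (simp_all add: diffeo_def u_eq image_subset_iff)
  have "((\<lambda>r. \<alpha> (\<Psi> (r, u))) has_real_derivative 0) (at r)" if r: "r \<in> T" for r
  proof -
    define m where "m = \<Psi> (r, u)"
    define \<alpha>' where "\<alpha>' = frechet_derivative \<alpha> (at m)"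
    define v where "v = frechet_derivative \<Psi> (at (r, u)) (1, 0)"
    have d\<alpha> [derivative_intros]: "(\<alpha> has_derivative \<alpha>') (at m)"
      unfolding \<alpha>'_def m_def by (rule smooth_on_has_derivative[OF U(2) in_U[OF r]])
    have d\<Psi>: "(\<Psi> has_derivative frechet_derivative \<Psi> (at (r, u))) (at (r, u))"
      by (rule smooth_on_has_derivative[of "T \<times> U1"]) (use \<Psi> r u in \<open>auto simp: diffeo_def\<close>)
    have "((\<lambda>r. \<Psi> (r, u)) has_derivative (\<lambda>h. frechet_derivative \<Psi> (at (r, u)) (h, 0))) (at r)"
      by (rule has_derivative_compose[where f = "\<lambda>r. (r, u)", OF _ d\<Psi>])
        (auto intro!: derivative_eq_intros)
    moreover have "frechet_derivative \<Psi> (at (r, u)) (h, 0) = h *\<^sub>R v" for h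
      using linear_cmul[OF has_derivative_linear[OF d\<Psi>], of h "(1, 0)"] by (simp add: v_def)
    ultimately have dc: "((\<lambda>r. \<Psi> (r, u)) has_vector_derivative v) (at r)"
      by (simp add: has_vector_derivative_def)
    \<comment> \<open>On the fibre the first component of \<open>Phi1\<close> equals the parameter
      and the other four are constant; differentiating all five determines the velocity
      \<open>v\<close> in terms of \<open>\<alpha>' v\<close>.\<close>
    note along = derivative_along_curve[OF dc _ T'(1) r, folded m_def]
    note inv' = inv[unfolded Phi1_eq_iff]
    have vx: "crd_x v = 1"
      by (rule along[where f = crd_x and d = 0])
        (auto intro!: derivative_eq_intros simp: inv')
    have vp: "crd_p v = 0"
      by (rule along[where f = crd_p and d = x3])
        (auto intro!: derivative_eq_intros simp: inv')
    have vq: "crd_q v = 0"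
      by (rule along[where f = crd_q and d = x4])
        (auto intro!: derivative_eq_intros simp: inv')
    have "crd_y v + (\<alpha> m * crd_x v + \<alpha>' v * crd_x m) = 0"
      by (rule along[where f = "\<lambda>b. crd_y b + \<alpha> b * crd_x b" and d = x1])
        (auto intro!: derivative_eq_intros simp: inv')
    then have vy: "crd_y v = - (\<alpha> m + \<alpha>' v * r)"
      using inv'[OF r] by (simp add: vx m_def)
    have "crd_z v - x3 * crd_x v - x4 * crd_y v = 0"
      by (rule along[where f = "\<lambda>b. crd_z b - x3 * crd_x b - x4 * crd_y b" and d = x2])
        (auto intro!: derivative_eq_intros simp: inv')
    then have vz: "crd_z v = crd_p m + crd_q m * crd_y v"
      using inv'[OF r] by (simp add: vx m_def)
    define B where "B = par_y \<alpha> m + crd_q m * par_z \<alpha> m"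
    have v_eq: "v = (1, crd_y v, crd_z v, 0, 0)"
      using jet_eq_crd[of v] by (simp add: vx vp vq)
    have "\<alpha>' v = par_x \<alpha> m + crd_y v * par_y \<alpha> m + crd_z v * par_z \<alpha> m"
      by (subst v_eq) (simp add: has_derivative_partials[OF d\<alpha>])
    also have "\<dots> = par_x \<alpha> m + crd_p m * par_z \<alpha> m + crd_y v * B"
      by (simp add: vz B_def algebra_simps)
    also have "par_x \<alpha> m + crd_p m * par_z \<alpha> m = \<alpha> m * B"
      using U(3) in_U[OF r] by (simp add: involutive_type_def B_def m_def)
    finally have "\<alpha>' v * (1 + r * B) = 0"
      by (simp add: vy algebra_simps)
    \<comment> \<open>The parameter \<open>r\<close> is the x coordinate of \<open>m\<close>, so
      this is the factor that genericity keeps away from zero.\<close>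
    moreover have "1 + r * B \<noteq> 0"
      using U(4) in_U[OF r] inv'[OF r] by (auto simp: generic_type_def B_def m_def)
    ultimately have "\<alpha>' v = 0" by simp
    moreover have "((\<lambda>r. \<alpha> (\<Psi> (r, u))) has_derivative (\<lambda>h. \<alpha>' (h *\<^sub>R v))) (at r)"
      by (rule has_derivative_compose[OF dc[unfolded has_vector_derivative_def] d\<alpha>[unfolded m_def]])
    moreover have "\<alpha>' (h *\<^sub>R v) = h *\<^sub>R \<alpha>' v" for h
      using linear_cmul[OF has_derivative_linear[OF d\<alpha>]] .
    ultimately show ?thesis
      by (simp add: has_field_derivative_def lambda_zero)
  qed
  then have "((\<lambda>r. \<alpha> (\<Psi> (r, u))) has_real_derivative 0) (at r within T)" if "r \<in> T" for r
    using that by (simp add: has_field_derivative_at_within)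
  from has_field_derivative_zero_constant[OF T'(2) this] show ?thesis
    using s by metis
qed

text \<open>Constancy on the fibre, together with a point \<open>s0\<close> of \<open>T\<close>,
  gives existence and uniqueness of the value chosen by \<open>THE\<close>.\<close>

lemma alpha_bar_eq:
  assumes "\<And>s. s \<in> T \<Longrightarrow> \<alpha> (\<Psi> (s, u)) = \<alpha> (\<Psi> (s0, u))" and "s0 \<in> T"
  shows "alpha_bar \<alpha> \<Psi> T u = \<alpha> (\<Psi> (s0, u))"
  unfolding alpha_bar_def by (rule the_equality) (use assms in \<open>blast, metis\<close>)

section \<open>Graphs in adapted coordinates\<close>

lemma continuous_on_crd:
  "continuous_on S crd_x" "continuous_on S crd_y" "continuous_on S crd_z"
  "continuous_on S crd_p" "continuous_on S crd_q"
  using bounded_linear_crd[THEN linear_continuous_on] .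

lemma smooth_on_shear:
  assumes "open J" "open Q" "crd_q ` Q \<subseteq> J" "smooth_on J g1" "smooth_on J g2" "smooth_on J g3"
  shows "smooth_on Q (\<lambda>b. (crd_x b, crd_y b + g1 (crd_q b), crd_z b + g2 (crd_q b),
    crd_p b + g3 (crd_q b), crd_q b))"
proof -
  note lin = smooth_on_bounded_linear[OF assms(2)]
  note comp = smooth_on_compose[OF assms(2) lin[OF bounded_linear_crd(5)] _ assms(3)]
  show ?thesis
    by (intro smooth_on_Pair smooth_on_add comp lin bounded_linear_crd assms)
qed

text \<open>In the coordinates \<Phi> the set is the graph of \<open>(h1, h2, h3)\<close> over the
  first and last coordinates. Subtracting these functions by the shear \<open>sh\<close> flattens it
  to the coordinate plane \<open>K\<close>.\<close>

lemma submanifold_graph: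
  fixes W V :: "jet set" and h1 h2 h3 :: "real \<Rightarrow> real"
  assumes \<Psi>: "diffeo W V \<Phi> \<Psi>" and J: "open J" and I: "open I"
    and smooth: "smooth_on J h1" "smooth_on J h2" "smooth_on J h3"
    and V: "\<And>s t. s \<in> I \<Longrightarrow> t \<in> J \<Longrightarrow> (s, h1 t, h2 t, h3 t, t) \<in> V"
  shows "submanifold 2 {\<Psi> (s, h1 t, h2 t, h3 t, t) | s t. s \<in> I \<and> t \<in> J}" (is "submanifold 2 ?S")
proof -
  define Q where "Q = {b. crd_x b \<in> I \<and> crd_q b \<in> J}"
  define sh where "sh = (\<lambda>b. (crd_x b, crd_y b + - h1 (crd_q b), crd_z b + - h2 (crd_q b),
    crd_p b + - h3 (crd_q b), crd_q b))"
  define sh' where "sh' = (\<lambda>b. (crd_x b, crd_y b + h1 (crd_q b), crd_z b + h2 (crd_q b),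
    crd_p b + h3 (crd_q b), crd_q b))"
  \<comment> \<open>The restriction to \<open>Q\<close> puts the first and last coordinates in
    \<open>I\<close> and \<open>J\<close>, so that every point of \<open>V' \<inter> K\<close> comes
    from a point of the set.\<close>
  define W' where "W' = W \<inter> \<Phi> -` (V \<inter> Q)"
  define V' where "V' = Q \<inter> sh' -` V"
  define K where "K = range (\<lambda>(s, t). (s, 0, 0, 0, t) :: jet)"
  note \<Psi>' = \<Psi>[unfolded diffeo_def]
  have Q: "open Q"
  proof -
    have "Q = crd_x -` I \<inter> crd_q -` J" by (auto simp: Q_def)
    then show ?thesis
      using open_vimage[OF I continuous_on_crd(1)] open_vimage[OF J continuous_on_crd(5)] by auto
  qed
  have sm: "smooth_on Q sh" "smooth_on Q sh'"
    unfolding sh_def sh'_def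
    by (intro smooth_on_shear[OF J Q] smooth smooth_on_minus J; auto simp: Q_def)+
  \<comment> \<open>Both shears fix the last coordinate, on which the shifts depend, and the first;
    hence they undo each other and preserve \<open>Q\<close>.\<close>
  have sh [simp]: "sh (sh' b) = b" "sh' (sh b) = b" "sh b \<in> Q \<longleftrightarrow> b \<in> Q" "sh' b \<in> Q \<longleftrightarrow> b \<in> Q" for b
    using jet_eq_crd[of b] by (simp_all add: sh_def sh'_def Q_def)
  have W': "open W'"
    unfolding W'_def using \<Psi>' Q smooth_on_continuous
    by (intro continuous_open_preimage) auto
  have V': "open V'"
    unfolding V'_def using \<Psi>' Q smooth_on_continuous[OF sm(2)]
    by (intro continuous_open_preimage) auto
  have f: "smooth_on W' (\<lambda>b. sh (\<Phi> b))"
    by (rule smooth_on_compose[OF W' smooth_on_subset[of W] sm(1)]) (use \<Psi>' in \<open>auto simp: W'_def\<close>)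
  have g: "smooth_on V' (\<lambda>b. \<Psi> (sh' b))"
    by (rule smooth_on_compose[OF V' smooth_on_subset[OF sm(2)], of V]) (use \<Psi>' in \<open>auto simp: V'_def\<close>)
  have diffeo: "diffeo W' V' (\<lambda>b. sh (\<Phi> b)) (\<lambda>b. \<Psi> (sh' b))"
    unfolding diffeo_def using W' V' f g \<Psi>' by (auto simp: W'_def V'_def image_subset_iff)
  have lin: "linear (\<lambda>(s, t). (s, 0, 0, 0, t) :: jet)"
    by (rule linearI) auto
  then have K: "subspace K"
    unfolding K_def by (rule linear_subspace_image) simp
  have dim: "dim K = 2"
    unfolding K_def by (subst dim_image_eq[OF lin]) (auto simp: inj_on_def)
  have \<Phi>\<Psi>: "\<Phi> (\<Psi> (s, h1 t, h2 t, h3 t, t)) = (s, h1 t, h2 t, h3 t, t)"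
      "\<Psi> (s, h1 t, h2 t, h3 t, t) \<in> W'" if "s \<in> I" "t \<in> J" for s t
    using \<Psi>' V[OF that] that by (auto simp: W'_def Q_def image_subset_iff)
  have image: "(\<lambda>b. sh (\<Phi> b)) ` (?S \<inter> W') = V' \<inter> K"
  proof (intro equalityI subsetI)
    fix b assume "b \<in> (\<lambda>b. sh (\<Phi> b)) ` (?S \<inter> W')"
    then obtain s t where st: "s \<in> I" "t \<in> J" "b = sh (\<Phi> (\<Psi> (s, h1 t, h2 t, h3 t, t)))" by blast
    then have b: "b = (s, 0, 0, 0, t)" by (simp add: \<Phi>\<Psi> sh_def)
    then show "b \<in> V' \<inter> K"
      using V[OF st(1,2)] st by (auto simp: K_def V'_def Q_def sh'_def)
  next
    fix b assume b: "b \<in> V' \<inter> K"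
    then obtain s t where st: "b = (s, 0, 0, 0, t)" "s \<in> I" "t \<in> J"
      by (auto simp: K_def V'_def Q_def)
    then have "b = sh (\<Phi> (\<Psi> (s, h1 t, h2 t, h3 t, t)))" by (simp add: \<Phi>\<Psi> sh_def)
    then show "b \<in> (\<lambda>b. sh (\<Phi> b)) ` (?S \<inter> W')" using st \<Phi>\<Psi>(2)[OF st(2,3)] by blast
  qed
  show ?thesis
    unfolding submanifold_def
  proof
    fix a assume "a \<in> ?S"
    then have "a \<in> W'" using \<Phi>\<Psi>(2) by blast
    then show "\<exists>(W::jet set) (V::jet set) f g K.
        a \<in> W \<and> diffeo W V f g \<and> subspace K \<and> dim K = 2 \<and> f ` (?S \<inter> W) = V \<inter> K"
      by (intro exI conjI) (assumption, rule diffeo, rule K, rule dim, rule image)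
  qed
qed

text \<open>A tangent vector is the velocity of a curve in \<open>S\<close>, and \<open>f\<close> is
  zero along that curve. Equations satisfied on \<open>S\<close> thus differentiate to linear
  relations on tangent vectors.\<close>

lemma tangent_space_relation:
  fixes f :: "'a::euclidean_space \<Rightarrow> real"
  assumes "v \<in> tangent_space S a" and f: "(f has_derivative f') (at a)"
    and "\<And>b. b \<in> S \<Longrightarrow> f b = 0"
  shows "f' v = 0"
proof -
  obtain e c where c: "e > 0" "c ` {-e<..<e} \<subseteq> S" "c 0 = a" "(c has_vector_derivative v) (at 0)"
    using assms(1) by (auto simp: tangent_space_def)
  have "f (c r) = 0 + 0 * r" if "r \<in> {-e<..<e}" for r
    using assms(3) c(2) that by (simp add: image_subset_iff)
  then show ?thesis
    using derivative_along_curve[OF c(4), of f f' "{-e<..<e}"] f c(1,3) by auto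
qed

section \<open>The solution surface\<close>

text \<open>Bootstrapping: if \<mu> is of class \<open>Ck_on k\<close>, then so is the right-hand
  side of the equation, hence \<mu> has one more order. The map \<open>G\<close> stands for the
  insertion of t and the solution into the arguments of \<beta>.\<close>

lemma smooth_on_ode:
  fixes \<mu> :: "real \<Rightarrow> real" and \<beta> :: "'a::euclidean_space \<Rightarrow> real"
  assumes J: "open J" and \<beta>: "smooth_on R \<beta>"
    and R: "\<And>t. t \<in> J \<Longrightarrow> G t (\<mu> t) \<in> R"
    and G: "\<And>k. Ck_on k J \<mu> \<Longrightarrow> Ck_on k J (\<lambda>t. G t (\<mu> t))"
    and \<mu>: "\<And>t. t \<in> J \<Longrightarrow> (\<mu> has_real_derivative \<beta> (G t (\<mu> t))) (at t)"
  shows "smooth_on J \<mu>"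
  unfolding smooth_on_def
proof
  fix k
  show "Ck_on k J \<mu>"
  proof (induction k)
    case 0
    then show ?case
      using DERIV_isCont[OF \<mu>] by (simp add: continuous_at_imp_continuous_on)
  next
    case (Suc k)
    have "Ck_on k J (\<lambda>t. \<beta> (G t (\<mu> t)))"
      by (rule Ck_on_compose[OF J G[OF Suc], of R]) (use \<beta> R in \<open>auto simp: smooth_on_def\<close>)
    then have "Ck_on k J (\<lambda>t. \<beta> (G t (\<mu> t)) * v)" for v
      by (rule Ck_on_linear_image[OF J bounded_linear_mult_left])
    from Ck_on_Suc_has_derivative[OF J \<mu>[unfolded has_field_derivative_def] this]
    show ?case .
  qed
qed

theorem proposition6p16:
  fixes U :: "(real \<times> real \<times> real \<times> real \<times> real) set"
    and \<alpha> :: "real \<times> real \<times> real \<times> real \<times> real \<Rightarrow> real"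
    and W :: "(real \<times> real \<times> real \<times> real \<times> real) set"
    and T :: "real set"
    and U1 :: "(real \<times> real \<times> real \<times> real) set"
    and \<Psi> :: "real \<times> real \<times> real \<times> real \<times> real \<Rightarrow> real \<times> real \<times> real \<times> real \<times> real"
    and \<xi> \<mu> :: "real \<Rightarrow> real"
    and I1 J1 :: "real set"
  assumes "open U" and "smooth_on U \<alpha>"
    and "involutive_type U \<alpha>" and "generic_type U \<alpha>"
    and "W \<subseteq> U" and "open_interval T" and "open U1"
    and "diffeo W (T \<times> U1) (Phi1 \<alpha>) \<Psi>"
    and "open_interval I1" and "open_interval J1"
    and "smooth_on J1 \<xi>"
    and "\<And>s t. s \<in> I1 \<Longrightarrow> t \<in> J1 \<Longrightarrow> (s, - deriv \<xi> t, \<xi> t, \<mu> t, t) \<in> T \<times> U1"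
    and "\<And>t. t \<in> J1 \<Longrightarrow>
           \<mu> differentiable (at t) \<and>
           deriv \<mu> t - alpha_bar \<alpha> \<Psi> T (- deriv \<xi> t, \<xi> t, \<mu> t, t) = 0"
  shows "integral_manifold 2 U (diff_ideal U {contact_form, alpha_form \<alpha>})
           {(s, crd_y (\<Psi> (s, - deriv \<xi> t, \<xi> t, \<mu> t, t)),
             crd_z (\<Psi> (s, - deriv \<xi> t, \<xi> t, \<mu> t, t)), \<mu> t, t) | s t. s \<in> I1 \<and> t \<in> J1}"
proof -
  note \<Psi> = assms(8)[unfolded diffeo_def]
  have I: "open I1" "I1 \<noteq> {}" and J: "open J1" "J1 \<noteq> {}"
    using assms(9,10) by (auto simp: open_interval_def)
  let ?c = "\<lambda>t. (- deriv \<xi> t, \<xi> t, \<mu> t, t)"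
  let ?S = "{\<Psi> (s, ?c t) | s t. s \<in> I1 \<and> t \<in> J1}"
  obtain s0 where s0: "s0 \<in> I1" using I by blast
  obtain t0 where t0: "t0 \<in> J1" using J by blast
  have IT: "s \<in> T" if "s \<in> I1" for s using assms(12)[OF that t0] by simp
  have c: "?c t \<in> U1" if "t \<in> J1" for t using assms(12)[OF s0 that] by simp
  have \<Psi>_U: "\<Psi> (s, u) \<in> U" and inv: "Phi1 \<alpha> (\<Psi> (s, u)) = (s, u)" if "s \<in> T" "u \<in> U1" for s u
    using \<Psi> that subsetD[OF assms(5)] by (simp_all add: image_subset_iff)
  \<comment> \<open>A representative of \<open>alpha_bar\<close> at the fixed parameter
    \<open>s0\<close>; as a composition with \<Psi> it is visibly smooth.\<close>
  define \<beta> where "\<beta> u = \<alpha> (\<Psi> (s0, u))" for u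
  have const: "\<alpha> (\<Psi> (s, u)) = \<beta> u" if "s \<in> T" "u \<in> U1" for s u
    unfolding \<beta>_def
    by (rule involutive_const_on_fibres[OF assms(1-6,8) that(2,1) IT[OF s0]])
  have "smooth_on U1 (\<lambda>u. (s0, u))"
    by (rule smooth_on_Pair[OF assms(7) smooth_on_const[OF assms(7)]
          smooth_on_bounded_linear[OF assms(7) bounded_linear_ident]])
  then have "smooth_on U1 (\<lambda>u. \<Psi> (s0, u))"
    by (rule smooth_on_compose[OF assms(7), of _ "T \<times> U1"]) (use \<Psi> IT[OF s0] in auto)
  then have \<beta>: "smooth_on U1 \<beta>"
    unfolding \<beta>_def
    by (rule smooth_on_compose[OF assms(7) _ assms(2)])
      (use \<Psi>_U[OF IT[OF s0]] in blast)
  have \<mu>'_eq: "deriv \<mu> t = \<beta> (?c t)" if "t \<in> J1" for t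
  proof -
    have "alpha_bar \<alpha> \<Psi> T (?c t) = \<beta> (?c t)"
      unfolding \<beta>_def
      by (rule alpha_bar_eq[OF _ IT[OF s0]], rule const[OF _ c[OF that], unfolded \<beta>_def])
    then show ?thesis using assms(13)[OF that] by simp
  qed
  have \<mu>': "(\<mu> has_real_derivative deriv \<mu> t) (at t)" if "t \<in> J1" for t
    using assms(13)[OF that] by (metis real_differentiable_def DERIV_imp_deriv)
  have \<xi>1: "smooth_on J1 (deriv \<xi>)" by (rule smooth_on_deriv[OF J(1) assms(11)])
  have id: "smooth_on J1 (\<lambda>t. t)" by (rule smooth_on_bounded_linear[OF J(1) bounded_linear_ident])
  \<comment> \<open>Only differentiability of \<mu> is assumed; smoothness makes the surface a
    smooth graph and provides the second derivative of \<mu> used for its tangent vectors.\<close>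
  have \<mu>: "smooth_on J1 \<mu>"
  proof (rule smooth_on_ode[where G = "\<lambda>t m. (- deriv \<xi> t, \<xi> t, m, t)", OF J(1) \<beta> c])
    fix k assume "Ck_on k J1 \<mu>"
    then show "Ck_on k J1 ?c"
      using smooth_on_minus[OF J(1) \<xi>1] assms(11) id
      unfolding smooth_on_def by (simp add: Ck_on_Pair[OF J(1)])
  next
    fix t assume t: "t \<in> J1"
    show "(\<mu> has_real_derivative \<beta> (?c t)) (at t)"
      using \<mu>'[OF t] by (simp only: \<mu>'_eq[OF t])
  qed
  have \<mu>1: "smooth_on J1 (deriv \<mu>)" by (rule smooth_on_deriv[OF J(1) \<mu>])
  \<comment> \<open>With s = x and t = q, the components of \<open>Phi1\<close> and \<alpha> =
    \<mu>'(q) become equations for y, z and p; \<alpha> itself no longer occurs in those for y and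
    z.\<close>
  have point: "crd_x b \<in> I1 \<and> crd_q b \<in> J1 \<and> b \<in> U \<and>
      crd_y b = - deriv \<xi> (crd_q b) - crd_x b * deriv \<mu> (crd_q b) \<and>
      crd_z b = \<xi> (crd_q b) + \<mu> (crd_q b) * crd_x b + crd_q b * crd_y b \<and>
      crd_p b = \<mu> (crd_q b) \<and> \<alpha> b = deriv \<mu> (crd_q b)" if b: "b \<in> ?S" for b
  proof -
    obtain s t where st: "s \<in> I1" "t \<in> J1" "b = \<Psi> (s, ?c t)" using b by blast
    have "b \<in> U" and "Phi1 \<alpha> b = (s, ?c t)"
      unfolding st(3) using \<Psi>_U inv IT[OF st(1)] c[OF st(2)] by blast+
    moreover have "\<alpha> b = deriv \<mu> t"
      using const IT[OF st(1)] c[OF st(2)] by (simp add: st(3) \<mu>'_eq[OF st(2)])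
    ultimately show ?thesis
      using st(1,2) by (auto simp: Phi1_eq_iff algebra_simps)
  qed
  have S: "{(s, crd_y (\<Psi> (s, ?c t)), crd_z (\<Psi> (s, ?c t)), \<mu> t, t) | s t. s \<in> I1 \<and> t \<in> J1} = ?S"
  proof -
    have "(s, crd_y (\<Psi> (s, ?c t)), crd_z (\<Psi> (s, ?c t)), \<mu> t, t) = \<Psi> (s, ?c t)"
      if "s \<in> I1" "t \<in> J1" for s t
    proof -
      have "Phi1 \<alpha> (\<Psi> (s, ?c t)) = (s, ?c t)"
        using inv IT[OF that(1)] c[OF that(2)] by blast
      then show ?thesis
        using jet_eq_crd[of "\<Psi> (s, ?c t)"] by (simp add: Phi1_eq_iff)
    qed
    then show ?thesis by (intro Collect_cong) metis
  qed
  have sub: "submanifold 2 ?S"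
    by (rule submanifold_graph[OF assms(8) J(1) I(1) smooth_on_minus[OF J(1) \<xi>1] assms(11) \<mu> assms(12)])

  define \<alpha>' where "\<alpha>' a = frechet_derivative \<alpha> (at a)" for a
  have d\<alpha>: "(\<alpha> has_derivative \<alpha>' a) (at a)" if "a \<in> ?S" for a
    unfolding \<alpha>'_def using smooth_on_has_derivative[OF assms(2)] point[OF that] by blast
  \<comment> \<open>These are the differentials of the equations in \<open>point\<close>. They
    express dp and d\<alpha> as multiples of dq, and dy through dx and dq.\<close>
  have tangent: "crd_p v = deriv \<mu> (crd_q a) * crd_q v"
    "crd_y v = - deriv \<mu> (crd_q a) * crd_x v -
      (deriv (deriv \<xi>) (crd_q a) + crd_x a * deriv (deriv \<mu>) (crd_q a)) * crd_q v"
    "crd_z v = \<mu> (crd_q a) * crd_x v + crd_q a * crd_y v"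
    "\<alpha>' a v = deriv (deriv \<mu>) (crd_q a) * crd_q v"
    if a: "a \<in> ?S" and v: "v \<in> tangent_space ?S a" for a v
  proof -
    have q: "crd_q a \<in> J1" using point[OF a] by blast
    have chain: "((\<lambda>b. f (crd_q b)) has_derivative (\<lambda>w. crd_q w * deriv f (crd_q a))) (at a)"
      if "smooth_on J1 f" for f
      by (rule DERIV_compose_FDERIV[where g = crd_q, OF smooth_on_real_derivative[OF that q]
            bounded_linear_imp_has_derivative[OF bounded_linear_crd(5)]])
    note [derivative_intros] = chain[OF \<mu>] chain[OF \<mu>1] chain[OF assms(11)] chain[OF \<xi>1]
    note [derivative_intros] = d\<alpha>[OF a]
    note rel = tangent_space_relation[OF v]
    have "crd_p v - crd_q v * deriv \<mu> (crd_q a) = 0"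
      by (rule rel[where f = "\<lambda>b. crd_p b - \<mu> (crd_q b)"])
        (auto intro!: derivative_eq_intros simp: point)
    then show "crd_p v = deriv \<mu> (crd_q a) * crd_q v" by (simp add: algebra_simps)
    have "crd_y v + crd_q v * deriv (deriv \<xi>) (crd_q a) +
        (crd_x a * (crd_q v * deriv (deriv \<mu>) (crd_q a)) + crd_x v * deriv \<mu> (crd_q a)) = 0"
      by (rule rel[where f = "\<lambda>b. crd_y b + deriv \<xi> (crd_q b) + crd_x b * deriv \<mu> (crd_q b)"])
        (auto intro!: derivative_eq_intros simp: point)
    then show y: "crd_y v = - deriv \<mu> (crd_q a) * crd_x v -
      (deriv (deriv \<xi>) (crd_q a) + crd_x a * deriv (deriv \<mu>) (crd_q a)) * crd_q v"
      by (simp add: algebra_simps)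
    have "crd_z v - crd_q v * deriv \<xi> (crd_q a) -
        (\<mu> (crd_q a) * crd_x v + crd_q v * deriv \<mu> (crd_q a) * crd_x a) -
        (crd_q a * crd_y v + crd_q v * crd_y a) = 0"
      by (rule rel[where f = "\<lambda>b. crd_z b - \<xi> (crd_q b) - \<mu> (crd_q b) * crd_x b - crd_q b * crd_y b"])
        (auto intro!: derivative_eq_intros simp: point)
    \<comment> \<open>Substituting this value of y cancels the total coefficient of
      \<open>crd_q v\<close> in the preceding relation and leaves the contact condition.\<close>
    moreover have "crd_y a = - deriv \<xi> (crd_q a) - crd_x a * deriv \<mu> (crd_q a)"
      using point[OF a] by blast
    ultimately show "crd_z v = \<mu> (crd_q a) * crd_x v + crd_q a * crd_y v"
      by (simp add: algebra_simps)
    have "\<alpha>' a v - crd_q v * deriv (deriv \<mu>) (crd_q a) = 0"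
      by (rule rel[where f = "\<lambda>b. \<alpha> b - deriv \<mu> (crd_q b)"])
        (auto intro!: derivative_eq_intros simp: point)
    then show "\<alpha>' a v = deriv (deriv \<mu>) (crd_q a) * crd_q v" by (simp add: algebra_simps)
  qed
  have "pullback_incl ?S ` diff_ideal U {contact_form, alpha_form \<alpha>} = {\<lambda>a vs. 0}"
  proof (rule pullback_incl_diff_ideal_eq_zero[where \<alpha>' = \<alpha>'])
    fix a v assume a: "a \<in> ?S" and v: "v \<in> tangent_space ?S a"
    show "crd_z v = crd_p a * crd_x v + crd_q a * crd_y v"
      using tangent(3)[OF a v] point[OF a] by simp
    show "crd_p v = \<alpha> a * crd_q v"
      using tangent(1)[OF a v] point[OF a] by simp
    fix w assume w: "w \<in> tangent_space ?S a"
    \<comment> \<open>Since dp = \<mu>' dq and dy = - \<mu>' dx up to a multiple of dq, the products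
      dx \<and> dp and dy \<and> dq are opposite.\<close>
    show "crd_x v * crd_p w - crd_p v * crd_x w + crd_y v * crd_q w - crd_q v * crd_y w = 0"
      by (simp add: tangent(1,2)[OF a v] tangent(1,2)[OF a w] algebra_simps)
    \<comment> \<open>On tangent vectors d\<alpha> is a multiple of dq, so d\<alpha> \<and> dq
      vanishes.\<close>
    show "\<alpha>' a w * crd_q v = \<alpha>' a v * crd_q w"
      by (simp add: tangent(4)[OF a v] tangent(4)[OF a w])
  qed (rule d\<alpha>)
  then show ?thesis
    unfolding S integral_manifold_def using sub point by blast
qed

end
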